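(* Let $X_1,X_2,\dots$ be i.i.d. real-valued continuous random variables. For $p\in[-1,0)$ and $\alpha\in\overline{\mathbb{H}}$ let $f^{(\alpha)}_p(x)=(x+\alpha)^p$ and $$M^{f^{(\alpha)}_p}_n=\left(\frac1n\sum_{j=1}^n (X_j+\alpha)^p\right)^{1/p}-\alpha,\qquad G^{(\alpha)}_n=\prod_{j=1}^n (X_j+\alpha)^{1/n}-\alpha.$$ (i) Let $\alpha\in\overline{\mathbb{H}}$, let $n\ge2$, and assume that $X_1\in L^{1/n}$. Then $$\lim_{p\to-0} M^{f^{(\alpha)}_p}_n=G^{(\alpha)}_n\quad\text{almost surely and in } L^1.$$ (ii) Let $\alpha\in\mathbb{H}$, let $n\ge3$, and assume that $X_1\in L^{2/3+}$. Then $$\lim_{p\to-1+0} M^{f^{(\alpha)}_p}_n=M^{f^{(\alpha)}_{-1}}_n\quad\text{almost surely and in } L^1.$$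
   Context: $\mathbb{H}=\{z\in\mathbb{C}:\mathrm{Im}(z)>0\}$ and $\overline{\mathbb{H}}=\{z\in\mathbb{C}:\mathrm{Im}(z)\ge0\}$. Complex powers use the principal branch: $z^q=\exp(q\log z)$ with $\log z=\log r+i\theta$ for $z=r e^{i\theta}$, $r>0$, $\theta\in(-\pi,\pi]$ (and $0^q=0$ for $0<q<1$). $Y\in L^s$ means $E[|Y|^s]<+\infty$; $Y\in L^{s+}$ means $Y\in L^{s'}$ for some $s'>s$. $p\to-0$ means $p\to0$ with $p<0$, and $p\to-1+0$ means $p\to-1$ with $p>-1$. "Continuous" random variable means that its distribution function is continuous, i.e. $P(X_1=x)=0$ for every $x\in\mathbb{R}$. *)

theory Defs
  imports "HOL-Probability.Probability"
begin

text \<open>Complex powers are the library's \<^const>\<open>powr\<close>, i.e. principal powers with argument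
  in \<open>(-\<pi>, \<pi>]\<close> and \<open>0 powr q = 0\<close>. For real \<open>\<alpha>\<close> and \<open>p < 0\<close> the base \<open>X\<^sub>j + \<alpha>\<close> can vanish only
  on a null set when \<open>X\<^sub>j\<close> has a continuous distribution function.\<close>

definition f_pow :: "complex \<Rightarrow> real \<Rightarrow> real \<Rightarrow> complex" where
  "f_pow \<alpha> p x = (complex_of_real x + \<alpha>) powr complex_of_real p"

definition power_mean :: "complex \<Rightarrow> real \<Rightarrow> (nat \<Rightarrow> 'a \<Rightarrow> real) \<Rightarrow> nat \<Rightarrow> 'a \<Rightarrow> complex" where
  "power_mean \<alpha> p X n \<omega> =
     ((1 / of_nat n) * (\<Sum>j=1..n. f_pow \<alpha> p (X j \<omega>))) powr complex_of_real (1 / p) - \<alpha>"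

definition geometric_mean :: "complex \<Rightarrow> (nat \<Rightarrow> 'a \<Rightarrow> real) \<Rightarrow> nat \<Rightarrow> 'a \<Rightarrow> complex" where
  "geometric_mean \<alpha> X n \<omega> =
     (\<Prod>j=1..n. (complex_of_real (X j \<omega>) + \<alpha>) powr complex_of_real (1 / real n)) - \<alpha>"

text \<open>Sequences of random variables are indexed from 1; \<open>X 0\<close> is unconstrained.
  Measurability is part of \<^const>\<open>prob_space.indep_vars\<close>.\<close>

definition iid_sequence :: "'a measure \<Rightarrow> (nat \<Rightarrow> 'a \<Rightarrow> real) \<Rightarrow> bool" where
  "iid_sequence M X \<longleftrightarrow>
     prob_space.indep_vars M (\<lambda>_. borel) X {1..} \<and>
     (\<forall>j\<ge>1. distr M borel (X j) = distr M borel (X 1))"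

definition continuous_rv :: "'a measure \<Rightarrow> ('a \<Rightarrow> real) \<Rightarrow> bool" where
  "continuous_rv M Y \<longleftrightarrow> Y \<in> borel_measurable M \<and> continuous_on UNIV (cdf (distr M borel Y))"

definition in_L :: "'a measure \<Rightarrow> real \<Rightarrow> ('a \<Rightarrow> real) \<Rightarrow> bool" where
  "in_L M s Y \<longleftrightarrow> Y \<in> borel_measurable M \<and> integrable M (\<lambda>\<omega>. \<bar>Y \<omega>\<bar> powr s)"

definition in_L_plus :: "'a measure \<Rightarrow> real \<Rightarrow> ('a \<Rightarrow> real) \<Rightarrow> bool" where
  "in_L_plus M s Y \<longleftrightarrow> (\<exists>s'>s. in_L M s' Y)"

definition tendsto_AE :: "'a measure \<Rightarrow> ('i \<Rightarrow> 'a \<Rightarrow> complex) \<Rightarrow> ('a \<Rightarrow> complex) \<Rightarrow> 'i filter \<Rightarrow> bool" where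
  "tendsto_AE M Y Z F \<longleftrightarrow> (AE \<omega> in M. ((\<lambda>p. Y p \<omega>) \<longlongrightarrow> Z \<omega>) F)"

text \<open>The integrability clauses are essential: the Bochner integral of a non-integrable
  function is 0.\<close>

definition tendsto_L1 :: "'a measure \<Rightarrow> ('i \<Rightarrow> 'a \<Rightarrow> complex) \<Rightarrow> ('a \<Rightarrow> complex) \<Rightarrow> 'i filter \<Rightarrow> bool" where
  "tendsto_L1 M Y Z F \<longleftrightarrow>
     (\<forall>\<^sub>F p in F. integrable M (Y p)) \<and> integrable M Z \<and>
     ((\<lambda>p. \<integral>\<omega>. cmod (Y p \<omega> - Z \<omega>) \<partial>M) \<longlongrightarrow> 0) F"

end

theory Submission imports Defs "HOL-Real_Asymp.Real_Asymp" begin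

text \<open>
  Put \<open>Z\<^sub>j = X\<^sub>j + \<alpha>\<close> and \<open>S\<^sub>p = (1/n) \<Sum>\<^sub>j Z\<^sub>j\<^sup>p\<close>, so that \<open>S\<^sub>p powr (1/p) - \<alpha>\<close> is the power mean. Both claims
  follow from pointwise convergence and dominated convergence. As \<open>p\<close> is negative, an upper bound
  for \<open>\<bar>S\<^sub>p\<bar>\<^bsup>1/p\<^esup>\<close> is a lower bound for \<open>\<bar>S\<^sub>p\<bar>\<close>, and the danger is cancellation between the summands.
  It does not occur because all \<open>Z\<^sub>j\<close> lie in the closed upper half plane, so that the arguments of
  the \<open>Z\<^sub>j\<^sup>p\<close> lie in \<open>[p\<pi>, 0]\<close>.

  For \<open>p\<close> near \<open>0\<close> this sector is close to the positive real axis and real parts give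
  \<open>\<bar>S\<^sub>p\<bar> \<ge> cos(p\<pi>) (1/n) \<Sum>\<^sub>j \<bar>Z\<^sub>j\<bar>\<^sup>p\<close>. For \<open>p\<close> near \<open>-1\<close> the sector is almost a half plane, real parts
  are of no use, and imaginary parts take over: with \<open>q = -p\<close>, concavity gives
  \<open>sin(q\<theta>) \<ge> q sin \<theta>\<close>, and since \<open>Im Z\<^sub>j = Im \<alpha>\<close> for every \<open>j\<close>,
  \<open>\<bar>S\<^sub>p\<bar> \<ge> q (Im \<alpha>) (1/n) \<Sum>\<^sub>j \<bar>Z\<^sub>j\<bar>\<^bsup>-1-q\<^esup>\<close>.

  In both cases the inequality between arithmetic and geometric means
  (\<open>cmod_powr_le_geometric_mean\<close>) turns the bound into a constant multiple of a product of powers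
  of the \<open>\<bar>Z\<^sub>j\<bar>\<close>. The exponent is \<open>1/n\<close> in the first case and \<open>(1+q)/(nq)\<close> in the second; for \<open>n \<ge> 3\<close>
  the latter is at most \<open>(1+q)/(3q)\<close>, which tends to \<open>2/3\<close>. This is where the moment
  hypotheses come from: by independence the product is integrable as soon as each factor is
  (\<open>integrable_prod_shifted_moments\<close>).

  The pointwise limit at \<open>0\<close> is the exponential of the derivative of \<open>h \<mapsto> Ln ((1/n) \<Sum>\<^sub>j exp (h Ln Z\<^sub>j))\<close> at \<open>h = 0\<close>; it
  needs \<open>Z\<^sub>j \<noteq> 0\<close>, which holds almost surely because the distribution has no atoms. The limit at
  \<open>-1\<close> is continuity of powers away from the cut: the mean of the \<open>Z\<^sub>j\<^sup>-\<^sup>1\<close> has negative imaginary part.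
\<close>

section \<open>Analytic preliminaries\<close>

text \<open>The power is discontinuous along the cut \<open>\<real>\<^sub>\<le>\<^sub>0\<close>, so continuity does not give measurability at
  once. Off the cut it is continuous, and on the cut it equals the Borel function
  \<open>\<bar>z\<bar>\<^sup>q e\<^bsup>i\<pi>q\<^esup>\<close>.\<close>

lemma borel_measurable_powr_complex_const [measurable]:
  "(\<lambda>z::complex. z powr complex_of_real q) \<in> borel_measurable borel"
proof -
  have cut: "(\<real>\<^sub>\<le>\<^sub>0 :: complex set) \<in> sets borel"
    by (intro borel_closed) simp
  have off_cut: "(\<lambda>z::complex. indicator (- \<real>\<^sub>\<le>\<^sub>0) z *\<^sub>R (z powr complex_of_real q)) \<in> borel_measurable borel"
    using cut by (intro borel_measurable_continuous_on_indicator)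
      (auto intro!: continuous_on_powr_complex continuous_intros simp: complex_nonpos_Reals_iff)
  have on_cut: "z powr complex_of_real q = complex_of_real (cmod z powr q) * exp (\<i> * pi * q)"
    if "z \<in> \<real>\<^sub>\<le>\<^sub>0" for z
  proof (cases "z = 0")
    case False
    with that obtain r where r: "z = - complex_of_real r" "r > 0"
      by (metis (no_types, opaque_lifting) add.inverse_inverse neg_0_less_iff_less nonpos_Reals_cases
          of_real_minus order_less_le of_real_0)
    then have "Ln z = complex_of_real (ln r) + \<i> * pi"
      using Ln_minus[of "complex_of_real r"] by (simp add: Ln_of_real)
    then have "z powr complex_of_real q = exp (complex_of_real (q * ln r)) * exp (\<i> * pi * q)"
      using r by (simp add: powr_def algebra_simps flip: exp_add)
    then show ?thesis
      using r by (simp add: powr_def flip: exp_of_real)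
  qed simp
  have "(\<lambda>z::complex. z powr complex_of_real q) =
    (\<lambda>z. if z \<in> \<real>\<^sub>\<le>\<^sub>0 then complex_of_real (cmod z powr q) * exp (\<i> * pi * q)
         else indicator (- \<real>\<^sub>\<le>\<^sub>0) z *\<^sub>R (z powr complex_of_real q))"
    using on_cut by (auto simp: fun_eq_iff)
  also have "\<dots> \<in> borel_measurable borel"
    using cut off_cut by (intro measurable_If) auto
  finally show ?thesis .
qed

text \<open>Concavity of the sine on \<open>[0, \<pi>]\<close>, compared with the chord from \<open>0\<close>; it is proved by
  differentiating in \<open>t\<close>, as the cosine decreases on \<open>[0, \<pi>]\<close>.\<close>

lemma mult_sin_le_sin_mult:
  fixes q t :: real
  assumes "0 \<le> q" "q \<le> 1" "0 \<le> t" "t \<le> pi"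
  shows "q * sin t \<le> sin (q * t)"
proof -
  have "sin (q * 0) - q * sin 0 \<le> sin (q * t) - q * sin t"
  proof (rule DERIV_nonneg_imp_nondecreasing[OF assms(3)])
    fix x assume x: "0 \<le> x" "x \<le> t"
    have "((\<lambda>t. sin (q * t) - q * sin t) has_real_derivative q * (cos (q * x) - cos x)) (at x)"
      by (auto intro!: derivative_eq_intros simp: algebra_simps)
    moreover have "cos x \<le> cos (q * x)"
      using x assms by (intro cos_monotone_0_pi_le) (auto intro: mult_left_le_one_le)
    ultimately show "\<exists>y. ((\<lambda>t. sin (q * t) - q * sin t) has_real_derivative y) (at x) \<and> 0 \<le> y"
      using assms by fastforce
  qed
  then show ?thesis by simp
qed

lemma powr_complex_polar:
  assumes "z \<noteq> 0"
  shows "Re (z powr complex_of_real p) = cmod z powr p * cos (p * Arg z)"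
    and "Im (z powr complex_of_real p) = cmod z powr p * sin (p * Arg z)"
  using assms by (simp_all add: powr_def Re_exp Im_exp Arg_eq_Im_Ln)

section \<open>Lower bounds for the arithmetic mean of the powers\<close>

text \<open>The argument of \<open>z\<^sup>p\<close> is at most \<open>\<bar>p\<bar>\<pi>\<close> in absolute value. The bound is useful when
  \<open>\<bar>p\<bar> < 1/2\<close>, where the cosine is positive.\<close>

lemma Re_powr_upper_half_plane_ge:
  assumes "z \<noteq> 0" "Im z \<ge> 0" "\<bar>p\<bar> \<le> 1"
  shows "cos (p * pi) * cmod z powr p \<le> Re (z powr complex_of_real p)"
proof -
  have "0 \<le> Arg z" "Arg z \<le> pi"
    using assms Arg_eq_Im_Ln Im_Ln_pos_le[of z] by auto
  then have "cos (\<bar>p\<bar> * pi) \<le> cos (\<bar>p\<bar> * Arg z)"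
    using assms by (intro cos_monotone_0_pi_le mult_left_mono) auto
  then have "cos (p * pi) \<le> cos (p * Arg z)"
    by (cases "p \<ge> 0") auto
  then show ?thesis
    using mult_left_mono[of "cos (p * pi)" "cos (p * Arg z)" "cmod z powr p"]
    by (simp add: powr_complex_polar(1)[OF assms(1)] mult_ac)
qed

text \<open>Here \<open>sin (Arg z) = Im z / \<bar>z\<bar>\<close> supplies the additional factor \<open>\<bar>z\<bar>\<^sup>-\<^sup>1\<close>. Unlike the bound on real
  parts, this one does not degenerate as \<open>p\<close> tends to \<open>-1\<close>.\<close>

lemma Im_powr_upper_half_plane_le:
  assumes "Im z > 0" "-1 \<le> p" "p \<le> 0"
  shows "(- p * Im z) * cmod z powr (p - 1) \<le> - Im (z powr complex_of_real p)"
proof -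
  have z: "z \<noteq> 0" using assms(1) by auto
  have "0 \<le> Arg z" "Arg z \<le> pi"
    using assms z Arg_eq_Im_Ln Im_Ln_pos_le[of z] by auto
  then have "- p * sin (Arg z) \<le> sin (- p * Arg z)"
    using assms by (intro mult_sin_le_sin_mult) auto
  moreover have "sin (Arg z) = Im z / cmod z"
    using z by (metis Arg_eq_Im_Ln Im_divide_of_real complex_is_Real_iff exp_Ln Im_exp
        nonzero_mult_div_cancel_left norm_exp_eq_Re zero_less_norm_iff less_irrefl)
  ultimately have "cmod z powr p * (- p * (Im z / cmod z)) \<le> cmod z powr p * sin (- p * Arg z)"
    by (intro mult_left_mono) auto
  then show ?thesis
    using z powr_complex_polar(2)[OF z, of p] by (simp add: powr_diff mult_ac)
qed

text \<open>Raising to the negative power \<open>1/p\<close> reverses the lower bound on \<open>\<bar>S\<bar>\<close>. Bounding the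
  arithmetic mean by the geometric mean beforehand makes the result a product over \<open>j\<close>, whose
  expectation factorises for independent variables.\<close>

lemma cmod_powr_le_geometric_mean:
  fixes S :: complex and z :: "nat \<Rightarrow> complex"
  assumes n: "n > 0" and p: "p < 0" and c: "c > 0"
    and z: "\<And>j. j \<in> {1..n} \<Longrightarrow> z j \<noteq> 0"
    and S: "c * ((\<Sum>j=1..n. cmod (z j) powr r) / n) \<le> cmod S"
  shows "cmod (S powr complex_of_real (1 / p)) \<le> c powr (1 / p) * (\<Prod>j=1..n. cmod (z j) powr (r / (n * p)))"
proof -
  define G where "G = (\<Prod>j=1..n. cmod (z j) powr (r / n))"
  have "(\<Prod>j=1..n. cmod (z j) powr r) powr (1 / n) = G"
    unfolding G_def by (simp add: prod_powr_distrib powr_powr)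
  then have "G \<le> (\<Sum>j=1..n. cmod (z j) powr r) / n"
    using arith_geom_mean[of "{1..n}" "\<lambda>j. cmod (z j) powr r"] n
    by (simp add: sum_divide_distrib)
  then have "c * G \<le> cmod S"
    using c S by (meson mult_left_mono less_imp_le order_trans)
  moreover have G: "G > 0"
    unfolding G_def using z by (intro prod_pos) auto
  ultimately have "cmod S powr (1 / p) \<le> (c * G) powr (1 / p)"
    using c p by (intro powr_mono2') (auto simp: divide_simps)
  also have "\<dots> = c powr (1 / p) * G powr (1 / p)"
    using c G by (simp add: powr_mult)
  also have "G powr (1 / p) = (\<Prod>j=1..n. cmod (z j) powr (r / (n * p)))"
    unfolding G_def by (simp add: prod_powr_distrib powr_powr)
  finally show ?thesis
    by (simp add: norm_powr_real_powr')
qed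

lemma cmod_power_mean_near_0_le:
  fixes z :: "nat \<Rightarrow> complex"
  assumes n: "n > 0" and p: "-1/2 < p" "p < 0"
    and z: "\<And>j. j \<in> {1..n} \<Longrightarrow> z j \<noteq> 0" "\<And>j. j \<in> {1..n} \<Longrightarrow> Im (z j) \<ge> 0"
  shows "cmod ((1 / of_nat n * (\<Sum>j=1..n. z j powr complex_of_real p)) powr complex_of_real (1 / p))
    \<le> cos (p * pi) powr (1 / p) * (\<Prod>j=1..n. cmod (z j) powr (1 / n))"
proof -
  let ?S = "1 / of_nat n * (\<Sum>j=1..n. z j powr complex_of_real p)"
  have c: "cos (p * pi) > 0"
    using p mult_strict_right_mono[of "-1/2" p pi]
    by (intro cos_gt_zero_pi) (auto simp: mult_neg_pos intro: less_trans[of _ 0])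
  have "cos (p * pi) * ((\<Sum>j=1..n. cmod (z j) powr p) / n)
      \<le> (\<Sum>j=1..n. Re (z j powr complex_of_real p)) / n"
    using p z by (simp only: sum_distrib_left times_divide_eq_right)
       (intro divide_right_mono sum_mono Re_powr_upper_half_plane_ge; simp)
  also have "\<dots> = Re ?S"
    by (simp add: Re_divide_of_nat)
  also have "\<dots> \<le> cmod ?S"
    by (rule complex_Re_le_cmod)
  finally show ?thesis
    using cmod_powr_le_geometric_mean[OF n p(2) c z(1), where r = p and S = ?S] p(2) by simp
qed

lemma cmod_power_mean_upper_half_plane_le:
  fixes z :: "nat \<Rightarrow> complex"
  assumes n: "n > 0" and p: "-1 \<le> p" "p < 0" and b: "b > 0"
    and z: "\<And>j. j \<in> {1..n} \<Longrightarrow> Im (z j) = b"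
  shows "cmod ((1 / of_nat n * (\<Sum>j=1..n. z j powr complex_of_real p)) powr complex_of_real (1 / p))
    \<le> (- p * b) powr (1 / p) * (\<Prod>j=1..n. cmod (z j) powr ((p - 1) / (n * p)))"
proof -
  let ?S = "1 / of_nat n * (\<Sum>j=1..n. z j powr complex_of_real p)"
  have c: "- p * b > 0"
    using p b by (simp add: mult_neg_pos)
  have nz: "z j \<noteq> 0" if "j \<in> {1..n}" for j
    using z[OF that] b by auto
  have "(- p * b) * cmod (z j) powr (p - 1) \<le> - Im (z j powr complex_of_real p)"
    if "j \<in> {1..n}" for j
    using Im_powr_upper_half_plane_le[of "z j" p] z[OF that] b p by simp
  then have "(- p * b) * ((\<Sum>j=1..n. cmod (z j) powr (p - 1)) / n)
      \<le> (\<Sum>j=1..n. - Im (z j powr complex_of_real p)) / n"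
    by (simp only: sum_distrib_left times_divide_eq_right)
       (intro divide_right_mono sum_mono; simp)
  also have "\<dots> = - Im ?S"
    by (simp add: Im_divide_of_nat sum_negf)
  also have "\<dots> \<le> cmod ?S"
    using abs_Im_le_cmod[of ?S] by linarith
  finally show ?thesis
    using cmod_powr_le_geometric_mean[OF n p(2) c nz, where r = "p - 1" and S = ?S] by simp
qed

section \<open>Pointwise limits\<close>

text \<open>With \<open>S h\<close> the mean of the \<open>exp (h Ln z\<^sub>j)\<close> one has \<open>S 0 = 1\<close>, so \<open>Ln \<circ> S\<close> vanishes at \<open>0\<close> and
  \<open>Ln (S p) / p\<close> is its difference quotient, with limit the mean of the \<open>Ln z\<^sub>j\<close>.\<close>

lemma power_mean_tendsto_geometric_mean:
  fixes z :: "nat \<Rightarrow> complex"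
  assumes n: "n > 0" and z: "\<And>j. j \<in> {1..n} \<Longrightarrow> z j \<noteq> 0"
  shows "((\<lambda>p. (1 / of_nat n * (\<Sum>j=1..n. z j powr complex_of_real p)) powr complex_of_real (1 / p))
    \<longlongrightarrow> (\<Prod>j=1..n. z j powr complex_of_real (1 / real n))) (at_left 0)"
proof -
  define m where "m = 1 / of_nat n * (\<Sum>j=1..n. Ln (z j))"
  define S where "S h = 1 / of_nat n * (\<Sum>j=1..n. exp (h * Ln (z j)))" for h
  have S0: "S 0 = 1"
    using n by (simp add: S_def)
  \<comment> \<open>\<open>S\<close> is differentiated as a function of a complex variable, to which the chain rule for \<open>Ln\<close>
    applies; the limit is then restricted to the negative real axis.\<close>
  have dS: "(S has_field_derivative m) (at 0)"
    unfolding S_def m_def using n by (auto intro!: derivative_eq_intros)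
  have "((\<lambda>h. Ln (S h)) has_field_derivative (1 / S 0 * m)) (at 0)"
    using dS S0 by (auto intro!: derivative_eq_intros)
  then have "((\<lambda>h. Ln (S h) / h) \<longlongrightarrow> m) (at 0)"
    using S0 by (simp add: DERIV_def)
  moreover have of_real: "filterlim complex_of_real (at 0) (at_left 0)"
    by (auto simp: filterlim_at eventually_at_filter intro!: tendsto_eq_intros)
  ultimately have "((\<lambda>p. Ln (S (complex_of_real p)) / complex_of_real p) \<longlongrightarrow> m) (at_left 0)"
    by (rule filterlim_compose)
  then have lim: "((\<lambda>p. exp (Ln (S (complex_of_real p)) / complex_of_real p)) \<longlongrightarrow> exp m) (at_left 0)"
    by (rule tendsto_exp)
  have "(S \<longlongrightarrow> S 0) (at 0)"
    using dS DERIV_isCont isCont_def by blast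
  then have "((\<lambda>p. S (complex_of_real p)) \<longlongrightarrow> S 0) (at_left 0)"
    using of_real by (rule filterlim_compose)
  then have "\<forall>\<^sub>F p in at_left 0. S (complex_of_real p) \<noteq> 0"
    using S0 by (intro tendsto_imp_eventually_ne) auto
  then have "\<forall>\<^sub>F p in at_left 0. exp (Ln (S (complex_of_real p)) / complex_of_real p) =
    (1 / of_nat n * (\<Sum>j=1..n. z j powr complex_of_real p)) powr complex_of_real (1 / p)"
  proof eventually_elim
    case (elim p)
    have "1 / of_nat n * (\<Sum>j=1..n. z j powr complex_of_real p) = S (complex_of_real p)"
      using z by (simp add: S_def powr_def)
    with elim show ?case
      by (simp add: powr_def)
  qed
  with lim have "((\<lambda>p. (1 / of_nat n * (\<Sum>j=1..n. z j powr complex_of_real p)) powr complex_of_real (1 / p))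
    \<longlongrightarrow> exp m) (at_left 0)"
    by (rule Lim_transform_eventually)
  also have "exp m = (\<Prod>j=1..n. z j powr complex_of_real (1 / real n))"
    using z by (simp add: m_def sum_divide_distrib exp_sum powr_def)
  finally show ?thesis .
qed

text \<open>The negative imaginary part of the limiting mean keeps it off the cut of the outer power.\<close>

lemma power_mean_tendsto_harmonic_mean:
  fixes z :: "nat \<Rightarrow> complex"
  assumes n: "n > 0" and z: "\<And>j. j \<in> {1..n} \<Longrightarrow> Im (z j) > 0"
  shows "((\<lambda>p. (1 / of_nat n * (\<Sum>j=1..n. z j powr complex_of_real p)) powr complex_of_real (1 / p))
    \<longlongrightarrow> (1 / of_nat n * (\<Sum>j=1..n. z j powr complex_of_real (-1))) powr complex_of_real (1 / (-1)))
    (at_right (-1))"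
proof (rule tendsto_powr_complex)
  have notin: "z j \<notin> \<real>\<^sub>\<le>\<^sub>0" if "j \<in> {1..n}" for j
    using z[OF that] by (auto simp: complex_nonpos_Reals_iff)
  have "Im (z j powr complex_of_real (-1)) < 0" if "j \<in> {1..n}" for j
  proof -
    have "0 < 1 * Im (z j) * cmod (z j) powr (- 1 - 1)"
      using z[OF that] by (intro mult_pos_pos) auto
    also have "\<dots> \<le> - Im (z j powr complex_of_real (-1))"
      using Im_powr_upper_half_plane_le[of "z j" "-1"] z[OF that] by simp
    finally show ?thesis by simp
  qed
  then have "(\<Sum>j=1..n. Im (z j powr complex_of_real (-1))) < 0"
    using n sum_strict_mono[of "{1..n}" "\<lambda>j. Im (z j powr complex_of_real (-1))" "\<lambda>_. 0"] by auto
  then have "Im (1 / of_nat n * (\<Sum>j=1..n. z j powr complex_of_real (-1))) < 0"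
    using n by (simp add: Im_divide_of_nat divide_neg_pos)
  then show "1 / of_nat n * (\<Sum>j=1..n. z j powr complex_of_real (-1)) \<notin> \<real>\<^sub>\<le>\<^sub>0"
    by (metis complex_nonpos_Reals_iff less_irrefl)
  show "((\<lambda>p. 1 / of_nat n * (\<Sum>j=1..n. z j powr complex_of_real p))
      \<longlongrightarrow> 1 / of_nat n * (\<Sum>j=1..n. z j powr complex_of_real (-1))) (at_right (-1))"
    using notin by (intro tendsto_mult tendsto_const tendsto_sum tendsto_powr_complex tendsto_of_real
        tendsto_ident_at) auto
  show "((\<lambda>p. complex_of_real (1 / p)) \<longlongrightarrow> complex_of_real (1 / (-1))) (at_right (-1))"
    by (intro tendsto_of_real tendsto_divide tendsto_const tendsto_ident_at) simp
qed

section \<open>Domination and integrability\<close>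

text \<open>Dominated convergence for a limit in a real parameter, reduced to sequences. The parameter
  filter must be nontrivial, since otherwise the integrability of \<open>Z\<close> would not follow.\<close>

lemma tendsto_L1_dominated:
  fixes Y :: "real \<Rightarrow> 'a \<Rightarrow> complex"
  assumes Y[measurable]: "\<And>p. Y p \<in> borel_measurable M" and Z[measurable]: "Z \<in> borel_measurable M"
    and g: "integrable M g"
    and bound: "\<forall>\<^sub>F p in at x within A. AE \<omega> in M. cmod (Y p \<omega>) \<le> g \<omega>"
    and lim: "tendsto_AE M Y Z (at x within A)"
    and nontrivial: "at x within A \<noteq> bot"
  shows "tendsto_L1 M Y Z (at x within A)"
proof -
  have int: "integrable M (Y p)" if "AE \<omega> in M. cmod (Y p \<omega>) \<le> g \<omega>" for p
    using g Y
    by (rule Bochner_Integration.integrable_bound) (use that in eventually_elim, auto)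
  have seq: "integrable M Z \<and> (\<lambda>i. \<integral>\<omega>. cmod (Y (s i) \<omega> - Z \<omega>) \<partial>M) \<longlonglongrightarrow> 0"
    if s: "filterlim s (at x within A) sequentially" for s
  proof -
    obtain N where N: "\<And>i. i \<ge> N \<Longrightarrow> AE \<omega> in M. cmod (Y (s i) \<omega>) \<le> g \<omega>"
      using filterlim_iff[THEN iffD1, OF s, rule_format, OF bound]
      by (auto simp: eventually_sequentially)
    \<comment> \<open>The bound holds only eventually, so the sequence is shifted by \<open>N\<close>.\<close>
    have lim_s: "AE \<omega> in M. (\<lambda>i. Y (s (i + N)) \<omega>) \<longlonglongrightarrow> Z \<omega>"
      using lim unfolding tendsto_AE_def
      by eventually_elim (rule LIMSEQ_ignore_initial_segment, erule filterlim_compose[OF _ s])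
    have Z_int: "integrable M Z"
      by (rule integrable_dominated_convergence[where s = "\<lambda>i. Y (s (i + N))" and w = g])
        (use g lim_s N in auto)
    have "(\<lambda>i. \<integral>\<omega>. cmod (Y (s (i + N)) \<omega> - Z \<omega>) \<partial>M) \<longlonglongrightarrow> (\<integral>\<omega>. 0 \<partial>M)"
    proof (rule integral_dominated_convergence[where w = "\<lambda>\<omega>. g \<omega> + cmod (Z \<omega>)"])
      show "integrable M (\<lambda>\<omega>. g \<omega> + cmod (Z \<omega>))"
        using g Z_int by auto
      show "AE \<omega> in M. (\<lambda>i. cmod (Y (s (i + N)) \<omega> - Z \<omega>)) \<longlonglongrightarrow> 0"
        using lim_s by eventually_elim (auto intro: tendsto_norm_zero LIM_zero)
      show "AE \<omega> in M. norm (cmod (Y (s (i + N)) \<omega> - Z \<omega>)) \<le> g \<omega> + cmod (Z \<omega>)" for i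
        using N[of "i + N"] by (auto elim!: eventually_mono intro: norm_triangle_le_diff)
    qed auto
    then show ?thesis
      using Z_int LIMSEQ_offset by force
  qed
  have "x islimpt A"
    using nontrivial trivial_limit_within by blast
  then obtain s where "\<And>i. s i \<in> A - {x}" "s \<longlonglongrightarrow> x"
    unfolding islimpt_sequential by blast
  then have "filterlim s (at x within A) sequentially"
    by (simp add: filterlim_at)
  then have "integrable M Z"
    using seq by blast
  moreover have "((\<lambda>p. \<integral>\<omega>. cmod (Y p \<omega> - Z \<omega>) \<partial>M) \<longlongrightarrow> 0) (at x within A)"
    unfolding tendsto_at_iff_sequentially comp_def
    using seq by (auto simp: filterlim_at)
  moreover have "\<forall>\<^sub>F p in at x within A. integrable M (Y p)"
    using bound by eventually_elim (rule int)
  ultimately show ?thesis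
    by (simp add: tendsto_L1_def)
qed

lemma powr_add_le:
  fixes x y s :: real
  assumes "x \<ge> 0" "y \<ge> 0" "s \<ge> 0"
  shows "(x + y) powr s \<le> 2 powr s * (x powr s + y powr s)"
proof -
  have "(x + y) powr s \<le> (2 * max x y) powr s"
    using assms by (intro powr_mono2) auto
  also have "\<dots> = 2 powr s * max x y powr s"
    using assms by (simp add: powr_mult)
  also have "max x y powr s \<le> x powr s + y powr s"
    by (auto simp: max_def)
  finally show ?thesis
    by simp
qed

text \<open>The common integrable dominator. The summand \<open>1\<close> in each factor makes it dominate all
  products with a nonnegative exponent at most \<open>s\<close>, which matters when the exponent varies with \<open>p\<close>.\<close>

lemma integrable_prod_shifted_moments:
  assumes "prob_space M" and iid: "iid_sequence M X" and L: "in_L M s (X 1)" and s: "s \<ge> 0"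
  shows "integrable M (\<lambda>\<omega>. \<Prod>j=1..n. 1 + cmod (complex_of_real (X j \<omega>) + \<alpha>) powr s)"
proof -
  interpret prob_space M by fact
  define \<phi> where "\<phi> x = 1 + cmod (complex_of_real x + \<alpha>) powr s" for x
  have \<phi>_meas[measurable]: "\<phi> \<in> borel_measurable borel"
    unfolding \<phi>_def by measurable
  have indep: "indep_vars (\<lambda>_. borel) X {1..}"
    using iid by (simp add: iid_sequence_def)
  then have X[measurable]: "X j \<in> borel_measurable M" if "j \<ge> 1" for j
    using that by (auto simp: indep_vars_def)
  have "integrable M (\<lambda>\<omega>. 1 + 2 powr s * (\<bar>X 1 \<omega>\<bar> powr s + cmod \<alpha> powr s))"
    using L by (auto simp: in_L_def)
  then have "integrable M (\<lambda>\<omega>. \<phi> (X 1 \<omega>))"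
  proof (rule Bochner_Integration.integrable_bound)
    show "(\<lambda>\<omega>. \<phi> (X 1 \<omega>)) \<in> borel_measurable M"
      by measurable
    have "\<bar>\<phi> x\<bar> \<le> \<bar>1 + 2 powr s * (\<bar>x\<bar> powr s + cmod \<alpha> powr s)\<bar>" for x
    proof -
      have "cmod (complex_of_real x + \<alpha>) powr s \<le> (\<bar>x\<bar> + cmod \<alpha>) powr s"
        using s norm_triangle_ineq[of "complex_of_real x" \<alpha>] by (intro powr_mono2) auto
      also have "\<dots> \<le> 2 powr s * (\<bar>x\<bar> powr s + cmod \<alpha> powr s)"
        using s by (intro powr_add_le) auto
      finally show ?thesis
        by (simp add: \<phi>_def)
    qed
    then show "AE \<omega> in M. norm (\<phi> (X 1 \<omega>)) \<le> norm (1 + 2 powr s * (\<bar>X 1 \<omega>\<bar> powr s + cmod \<alpha> powr s))"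
      by simp
  qed
  then have "integrable (distr M borel (X 1)) \<phi>"
    using integrable_distr_eq[OF X \<phi>_meas, of 1] by simp
  then have int: "integrable M (\<lambda>\<omega>. \<phi> (X j \<omega>))" if "j \<ge> 1" for j
    using iid that integrable_distr_eq[OF X[OF that] \<phi>_meas]
    unfolding iid_sequence_def by metis
  have "indep_vars (\<lambda>_. borel) (\<lambda>j \<omega>. \<phi> (X j \<omega>)) {1..n}"
    by (rule indep_vars_compose2[OF indep_vars_subset[OF indep]]) auto
  then have "integrable M (\<lambda>\<omega>. \<Prod>j=1..n. \<phi> (X j \<omega>))"
    using int by (intro indep_vars_integrable) auto
  then show ?thesis
    by (simp add: \<phi>_def)
qed

text \<open>The sum can vanish only where \<open>X\<^sub>j = - Re \<alpha>\<close>, and this event has probability \<open>0\<close> because a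
  continuous distribution function has no atoms.\<close>

lemma AE_shifted_nonzero:
  assumes "prob_space M" and iid: "iid_sequence M X" and cont: "continuous_rv M (X 1)"
  shows "AE \<omega> in M. \<forall>j\<in>{1..n}. complex_of_real (X j \<omega>) + \<alpha> \<noteq> 0"
proof -
  interpret prob_space M by fact
  have "AE \<omega> in M. complex_of_real (X j \<omega>) + \<alpha> \<noteq> 0" if j: "j \<in> {1..n}" for j
  proof -
    have X[measurable]: "X j \<in> borel_measurable M"
      using iid j by (auto simp: iid_sequence_def indep_vars_def)
    interpret D: real_distribution "distr M borel (X j)"
      by (intro real_distribution_distr) measurable
    have distr_eq: "distr M borel (X j) = distr M borel (X 1)"
      using iid j unfolding iid_sequence_def atLeastAtMost_iff by blast
    have "isCont (cdf (distr M borel (X j))) (- Re \<alpha>)"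
      unfolding distr_eq using cont by (simp add: continuous_rv_def continuous_on_eq_continuous_at)
    then have "measure (distr M borel (X j)) {- Re \<alpha>} = 0"
      by (simp add: D.isCont_cdf)
    then have "{- Re \<alpha>} \<in> null_sets (distr M borel (X j))"
      by (simp add: null_sets_def D.emeasure_eq_measure)
    then have "AE x in distr M borel (X j). x \<notin> {- Re \<alpha>}"
      by (rule AE_not_in)
    then have "AE \<omega> in M. X j \<omega> \<notin> {- Re \<alpha>}"
      by (rule AE_distrD[OF X])
    then show ?thesis
      by eventually_elim (auto simp: complex_eq_iff)
  qed
  then show ?thesis
    by (intro AE_finite_allI) auto
qed

lemma prod_powr_le_prod_one_plus:
  fixes a :: "'i \<Rightarrow> real"
  assumes "\<And>i. i \<in> I \<Longrightarrow> a i > 0" "0 \<le> e" "e \<le> s"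
  shows "(\<Prod>i\<in>I. a i powr e) \<le> (\<Prod>i\<in>I. 1 + a i powr s)"
proof (rule prod_mono, safe)
  fix i assume "i \<in> I"
  then have a: "a i > 0" using assms by auto
  show "a i powr e \<le> 1 + a i powr s"
  proof (cases "a i \<le> 1")
    case True
    then have "a i powr e \<le> 1" using a assms by (intro powr_le1) auto
    then show ?thesis by (simp add: add_increasing2)
  next
    case False
    then have "a i powr e \<le> a i powr s" using assms(3) by (intro powr_mono) auto
    then show ?thesis by simp
  qed
qed auto

section \<open>Convergence of the power means\<close>

lemma borel_measurable_means:
  assumes "prob_space M" "iid_sequence M X"
  shows "power_mean \<alpha> p X n \<in> borel_measurable M"
    and "geometric_mean \<alpha> X n \<in> borel_measurable M"
proof -
  interpret prob_space M by fact
  have X[measurable]: "X j \<in> borel_measurable M" if "j \<in> {1..n}" for j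
    using assms(2) that by (auto simp: iid_sequence_def indep_vars_def)
  show "power_mean \<alpha> p X n \<in> borel_measurable M"
    unfolding power_mean_def f_pow_def by measurable
  show "geometric_mean \<alpha> X n \<in> borel_measurable M"
    unfolding geometric_mean_def by measurable
qed

theorem proposition4p3:
  fixes M :: "'a measure" and X :: "nat \<Rightarrow> 'a \<Rightarrow> real"
  assumes "prob_space M"
    and "iid_sequence M X"
    and "continuous_rv M (X 1)"
  shows
    "(\<forall>(\<alpha>::complex) (n::nat). Im \<alpha> \<ge> 0 \<longrightarrow> n \<ge> 2 \<longrightarrow> in_L M (1 / real n) (X 1) \<longrightarrow>
        tendsto_AE M (\<lambda>p. power_mean \<alpha> p X n) (geometric_mean \<alpha> X n) (at_left 0) \<and>
        tendsto_L1 M (\<lambda>p. power_mean \<alpha> p X n) (geometric_mean \<alpha> X n) (at_left 0)) \<and>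
     (\<forall>(\<alpha>::complex) (n::nat). Im \<alpha> > 0 \<longrightarrow> n \<ge> 3 \<longrightarrow> in_L_plus M (2 / 3) (X 1) \<longrightarrow>
        tendsto_AE M (\<lambda>p. power_mean \<alpha> p X n) (power_mean \<alpha> (-1) X n) (at_right (-1)) \<and>
        tendsto_L1 M (\<lambda>p. power_mean \<alpha> p X n) (power_mean \<alpha> (-1) X n) (at_right (-1)))"
proof -
  note meas = borel_measurable_means[OF assms(1,2)]
  interpret prob_space M by fact
  have dominator: "integrable M (\<lambda>\<omega>. C * (\<Prod>j=1..n. 1 + cmod (complex_of_real (X j \<omega>) + \<alpha>) powr s) + cmod \<alpha>)"
    if "in_L M s (X 1)" "s \<ge> 0" for C \<alpha> s n
    using integrable_prod_shifted_moments[OF assms(1,2) that] by simp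
  have to_geometric: "tendsto_AE M (\<lambda>p. power_mean \<alpha> p X n) (geometric_mean \<alpha> X n) (at_left 0) \<and>
      tendsto_L1 M (\<lambda>p. power_mean \<alpha> p X n) (geometric_mean \<alpha> X n) (at_left 0)"
    if \<alpha>: "Im \<alpha> \<ge> 0" and n: "n \<ge> 2" and L: "in_L M (1 / real n) (X 1)" for \<alpha> :: complex and n :: nat
  proof -
    have nz: "AE \<omega> in M. \<forall>j\<in>{1..n}. complex_of_real (X j \<omega>) + \<alpha> \<noteq> 0"
      by (rule AE_shifted_nonzero[OF assms])
    have ae: "tendsto_AE M (\<lambda>p. power_mean \<alpha> p X n) (geometric_mean \<alpha> X n) (at_left 0)"
      unfolding tendsto_AE_def power_mean_def geometric_mean_def f_pow_def
      using nz by eventually_elim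
        (use n in \<open>intro tendsto_diff tendsto_const power_mean_tendsto_geometric_mean; auto\<close>)
    \<comment> \<open>Since \<open>cos (p\<pi>) = 1 - O(p\<^sup>2)\<close>, the constant stays bounded although the exponent \<open>1/p\<close> blows up.\<close>
    have "((\<lambda>p. cos (p * pi) powr (1 / p)) \<longlongrightarrow> 1) (at_left 0)"
      by real_asymp
    then have "\<forall>\<^sub>F p in at_left 0. cos (p * pi) powr (1 / p) < 2"
      by (rule order_tendstoD) simp
    moreover have "\<forall>\<^sub>F p in at_left (0::real). -1/2 < p \<and> p < 0"
      by (rule eventually_at_leftI[of "-1/2"]) auto
    ultimately have "\<forall>\<^sub>F p in at_left 0. AE \<omega> in M. cmod (power_mean \<alpha> p X n \<omega>)
       \<le> 2 * (\<Prod>j=1..n. 1 + cmod (complex_of_real (X j \<omega>) + \<alpha>) powr (1 / n)) + cmod \<alpha>"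
    proof eventually_elim
      case (elim p)
      show ?case
        using nz
      proof eventually_elim
        case (elim \<omega>)
        let ?z = "\<lambda>j. complex_of_real (X j \<omega>) + \<alpha>"
        have "cmod ((1 / of_nat n * (\<Sum>j=1..n. ?z j powr complex_of_real p)) powr complex_of_real (1 / p))
            \<le> cos (p * pi) powr (1 / p) * (\<Prod>j=1..n. cmod (?z j) powr (1 / n))"
          using elim \<open>_ \<and> _\<close> \<alpha> n by (intro cmod_power_mean_near_0_le) auto
        also have "\<dots> \<le> 2 * (\<Prod>j=1..n. 1 + cmod (?z j) powr (1 / n))"
          using elim \<open>_ < 2\<close> by (intro mult_mono prod_powr_le_prod_one_plus prod_nonneg) auto
        finally show ?case
          unfolding power_mean_def f_pow_def by (rule order_trans[OF norm_triangle_ineq4 add_right_mono])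
      qed
    qed
    then have "tendsto_L1 M (\<lambda>p. power_mean \<alpha> p X n) (geometric_mean \<alpha> X n) (at_left 0)"
      by (intro tendsto_L1_dominated[OF meas dominator[OF L] _ ae]) auto
    with ae show ?thesis ..
  qed
  have to_harmonic: "tendsto_AE M (\<lambda>p. power_mean \<alpha> p X n) (power_mean \<alpha> (-1) X n) (at_right (-1)) \<and>
      tendsto_L1 M (\<lambda>p. power_mean \<alpha> p X n) (power_mean \<alpha> (-1) X n) (at_right (-1))"
    if \<alpha>: "Im \<alpha> > 0" and n: "n \<ge> 3" and L_plus: "in_L_plus M (2 / 3) (X 1)" for \<alpha> :: complex and n :: nat
  proof -
    from L_plus obtain s where s: "s > 2 / 3" and L: "in_L M s (X 1)"
      by (auto simp: in_L_plus_def)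
    have ae: "tendsto_AE M (\<lambda>p. power_mean \<alpha> p X n) (power_mean \<alpha> (-1) X n) (at_right (-1))"
      unfolding tendsto_AE_def power_mean_def f_pow_def
      using n \<alpha> by (intro AE_I2 tendsto_diff tendsto_const power_mean_tendsto_harmonic_mean) auto
    \<comment> \<open>The limit of the constant \<open>(- p * Im \<alpha>) powr (1 / p)\<close> at \<open>-1\<close> is \<open>1 / Im \<alpha>\<close>.\<close>
    define C where "C = 1 / Im \<alpha> + 1"
    have "((\<lambda>p. (- p * Im \<alpha>) powr (1 / p)) \<longlongrightarrow> (- (-1) * Im \<alpha>) powr (1 / (-1))) (at_right (-1))"
      using \<alpha> by (intro tendsto_intros) auto
    then have "\<forall>\<^sub>F p in at_right (-1). (- p * Im \<alpha>) powr (1 / p) < C"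
      by (rule order_tendstoD) (use \<alpha> in \<open>simp add: C_def powr_minus_divide\<close>)
    \<comment> \<open>The limit of the exponent is \<open>2/3\<close>, so any \<open>s > 2/3\<close> eventually exceeds it.\<close>
    moreover have "((\<lambda>p. (p - 1) / (3 * p)) \<longlongrightarrow> (-1 - 1) / (3 * (-1 :: real))) (at_right (-1))"
      by (intro tendsto_intros) auto
    then have "\<forall>\<^sub>F p in at_right (-1). (p - 1) / (3 * p) < s"
      by (rule order_tendstoD) (use s in simp)
    moreover have "\<forall>\<^sub>F p in at_right (-1::real). -1 < p \<and> p < 0"
      by (rule eventually_at_rightI[of _ 0]) auto
    ultimately have "\<forall>\<^sub>F p in at_right (-1). AE \<omega> in M. cmod (power_mean \<alpha> p X n \<omega>)
       \<le> C * (\<Prod>j=1..n. 1 + cmod (complex_of_real (X j \<omega>) + \<alpha>) powr s) + cmod \<alpha>"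
    proof eventually_elim
      case (elim p)
      then have p: "-1 < p" "p < 0" by auto
      have "0 \<le> (p - 1) / (n * p)"
        using p by (intro divide_nonpos_nonpos) (auto simp: mult_nonneg_nonpos)
      moreover have "(p - 1) / (n * p) \<le> (p - 1) / (3 * p)"
        using n p by (intro divide_left_mono_neg) (auto simp: mult_neg_neg mult_pos_neg mult_right_mono_neg intro: mult_neg_neg)
      ultimately have e: "0 \<le> (p - 1) / (n * p)" "(p - 1) / (n * p) \<le> s"
        using elim by auto
      show ?case
      proof (rule AE_I2)
        fix \<omega>
        let ?z = "\<lambda>j. complex_of_real (X j \<omega>) + \<alpha>"
        have nz: "?z j \<noteq> 0" for j
          using \<alpha> by (auto simp: complex_eq_iff)
        have "cmod ((1 / of_nat n * (\<Sum>j=1..n. ?z j powr complex_of_real p)) powr complex_of_real (1 / p))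
            \<le> (- p * Im \<alpha>) powr (1 / p) * (\<Prod>j=1..n. cmod (?z j) powr ((p - 1) / (n * p)))"
          using p \<alpha> n by (intro cmod_power_mean_upper_half_plane_le) auto
        also have "\<dots> \<le> C * (\<Prod>j=1..n. 1 + cmod (?z j) powr s)"
          using elim e nz \<alpha>
          by (intro mult_mono prod_powr_le_prod_one_plus prod_nonneg) (auto simp: C_def)
        finally show "cmod (power_mean \<alpha> p X n \<omega>) \<le> C * (\<Prod>j=1..n. 1 + cmod (?z j) powr s) + cmod \<alpha>"
          unfolding power_mean_def f_pow_def by (rule order_trans[OF norm_triangle_ineq4 add_right_mono])
      qed
    qed
    then have "tendsto_L1 M (\<lambda>p. power_mean \<alpha> p X n) (power_mean \<alpha> (-1) X n) (at_right (-1))"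
      using s by (intro tendsto_L1_dominated[OF meas(1) meas(1) dominator[OF L] _ ae]) auto
    with ae show ?thesis ..
  qed
  from to_geometric to_harmonic show ?thesis
    by blast
qed

end
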